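(* Let $d>2$ be a prime number, $\omega=\exp(2\pi i/d)$, and fix values $a,b\in\{0,\dots,d-1\}$. Let $\mathbb{X}_d,\mathbb{Z}_d$ be the generalised Pauli matrices and put $W=\mathbb{X}_d^b\mathbb{Z}_d^a$. Then the $d$ maximally entangled states $\frac{1}{\sqrt d}|W^k\rangle$, $k=0,\dots,d-1$, form a basis of a $d$-dimensional subspace $S$ of $\mathbb{C}^d\otimes\mathbb{C}^d$. Moreover, for each $r=1,\dots,d-1$ the vectors $$|W\rangle^{(r)}_s=\frac1d\sum_{k=0}^{d-1}(\omega^s)^{d-k}(\omega^{-r})^{\alpha_{(k)}}|W^k\rangle,\qquad s=0,\dots,d-1,\quad \alpha_{(k)}=k+(k+1)+\dots+(d-1),$$ form a basis (the $r$-th basis, with $s$-th state $|W\rangle^{(r)}_s$) of $S$ consisting of maximally entangled states, and these $d-1$ bases together with the basis $\{\frac{1}{\sqrt d}|W^k\rangle\}_{k=0}^{d-1}$ are pairwise mutually unbiased bases of $S$.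
   Context: $\{|0\rangle,\dots,|d-1\rangle\}$ is the standard orthonormal basis of $\mathbb{C}^d$ and $\oplus$ is addition modulo $d$. The generalised Pauli matrices are $\mathbb{X}_d|n\rangle=|n\oplus 1\rangle$ and $\mathbb{Z}_d|n\rangle=\omega^n|n\rangle$. For a matrix $U\in M(d,\mathbb{C})$ (the $d\times d$ complex matrices), $|U\rangle=\sum_{m,n=0}^{d-1}\langle n|U|m\rangle\,|m\rangle\otimes|n\rangle\in\mathbb{C}^d\otimes\mathbb{C}^d$; e.g. $|\mathbb{X}_d^b\mathbb{Z}_d^a\rangle=\sum_n\omega^{an}|n\rangle\otimes|n\oplus b\rangle$. A unit vector $|\psi\rangle\in\mathbb{C}^d\otimes\mathbb{C}^d$ is maximally entangled if both partial traces of $|\psi\rangle\langle\psi|$ equal $\mathbb{I}_d/d$, where $\mathbb{I}_d$ is the identity matrix. Two distinct orthonormal bases $\{|\varphi_i\rangle\}$, $\{|\phi_j\rangle\}$ of a $d$-dimensional inner product space are mutually unbiased if $|\langle\varphi_i|\phi_j\rangle|=1/\sqrt d$ for all $i,j=0,\dots,d-1$.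
   Formalization: The values a, b are assumed not both 0; for a = b = 0 we have W = I, all states |W^k⟩ coincide, and they cannot form a basis of a d-dimensional subspace. *)

theory Defs
  imports Complex_Main "HOL-Computational_Algebra.Primes" "Jordan_Normal_Form.VS_Connect"
begin

definition omega :: "nat \<Rightarrow> complex" where
  "omega d = exp (2 * of_real pi * \<i> / of_nat d)"

definition pauli_X :: "nat \<Rightarrow> complex mat" where
  "pauli_X d = mat d d (\<lambda>(i, j). if i = (j + 1) mod d then 1 else 0)"

definition pauli_Z :: "nat \<Rightarrow> complex mat" where
  "pauli_Z d = mat d d (\<lambda>(i, j). if i = j then omega d ^ j else 0)"

lemma pauli_X_unit_vec:
  assumes "n < d"
  shows "pauli_X d *\<^sub>v unit_vec d n = unit_vec d ((n + 1) mod d)"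
  using assms by (intro eq_vecI) (auto simp: pauli_X_def scalar_prod_right_unit)

lemma pauli_Z_unit_vec:
  assumes "n < d"
  shows "pauli_Z d *\<^sub>v unit_vec d n = omega d ^ n \<cdot>\<^sub>v unit_vec d n"
  using assms by (intro eq_vecI) (auto simp: pauli_Z_def scalar_prod_right_unit)

text \<open>The inner product is linear in its second argument, as in Dirac notation, while
  \<open>v \<bullet>c w\<close> conjugates \<open>w\<close>.\<close>

definition braket :: "complex vec \<Rightarrow> complex vec \<Rightarrow> complex" where
  "braket u v = v \<bullet>c u"

text \<open>\<open>\<complex>\<^sup>d \<otimes> \<complex>\<^sup>d\<close> is identified with \<open>\<complex>\<close>-vectors of dimension \<open>d * d\<close> by sending
  \<open>|i\<rangle> \<otimes> |j\<rangle>\<close> to the standard basis vector with index \<open>i * d + j\<close>.\<close>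

definition tensor_vec :: "nat \<Rightarrow> complex vec \<Rightarrow> complex vec \<Rightarrow> complex vec" where
  "tensor_vec d u v = vec (d * d) (\<lambda>i. u $ (i div d) * v $ (i mod d))"

definition vec_of_op :: "nat \<Rightarrow> complex mat \<Rightarrow> complex vec" where
  "vec_of_op d U = finsum_vec TYPE(complex) (d * d)
     (\<lambda>(m, n). U $$ (n, m) \<cdot>\<^sub>v tensor_vec d (unit_vec d m) (unit_vec d n))
     ({..<d} \<times> {..<d})"

definition projector :: "complex vec \<Rightarrow> complex mat" where
  "projector v = mat (dim_vec v) (dim_vec v) (\<lambda>(i, j). v $ i * cnj (v $ j))"

text \<open>Tracing out the first and the second tensor factor, respectively.\<close>

definition partial_trace_1 :: "nat \<Rightarrow> complex mat \<Rightarrow> complex mat" where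
  "partial_trace_1 d R = mat d d (\<lambda>(i, j). \<Sum>k<d. R $$ (k * d + i, k * d + j))"

definition partial_trace_2 :: "nat \<Rightarrow> complex mat \<Rightarrow> complex mat" where
  "partial_trace_2 d R = mat d d (\<lambda>(i, j). \<Sum>k<d. R $$ (i * d + k, j * d + k))"

definition maximally_entangled :: "nat \<Rightarrow> complex vec \<Rightarrow> bool" where
  "maximally_entangled d v \<longleftrightarrow>
     v \<in> carrier_vec (d * d) \<and> braket v v = 1 \<and>
     partial_trace_1 d (projector v) = (1 / of_nat d) \<cdot>\<^sub>m 1\<^sub>m d \<and>
     partial_trace_2 d (projector v) = (1 / of_nat d) \<cdot>\<^sub>m 1\<^sub>m d"

text \<open>\<open>f 0, \<dots>, f (m - 1)\<close> is an orthonormal basis of the subspace \<open>S\<close> of \<open>\<complex>\<^sup>N\<close>; orthonormality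
  makes the family injective, so \<open>m\<close> is the dimension of \<open>S\<close>.\<close>

definition onb_of :: "nat \<Rightarrow> complex vec set \<Rightarrow> nat \<Rightarrow> (nat \<Rightarrow> complex vec) \<Rightarrow> bool" where
  "onb_of N S m f \<longleftrightarrow>
     vectorspace.basis class_ring (module_vec TYPE(complex) N\<lparr>carrier := S\<rparr>) (f ` {..<m}) \<and>
     (\<forall>i<m. \<forall>j<m. braket (f i) (f j) = (if i = j then 1 else 0))"

definition mutually_unbiased ::
  "nat \<Rightarrow> complex vec set \<Rightarrow> nat \<Rightarrow> (nat \<Rightarrow> complex vec) \<Rightarrow> (nat \<Rightarrow> complex vec) \<Rightarrow> bool" where
  "mutually_unbiased N S m f g \<longleftrightarrow>
     onb_of N S m f \<and> onb_of N S m g \<and> f ` {..<m} \<noteq> g ` {..<m} \<and>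
     (\<forall>i<m. \<forall>j<m. cmod (braket (f i) (g j)) = 1 / sqrt (of_nat m))"

definition power_state :: "nat \<Rightarrow> complex mat \<Rightarrow> nat \<Rightarrow> complex vec" where
  "power_state d W k = (1 / of_real (sqrt (of_nat d))) \<cdot>\<^sub>v vec_of_op d (W ^\<^sub>m k)"

definition alpha :: "nat \<Rightarrow> nat \<Rightarrow> nat" where
  "alpha d k = \<Sum>{k..<d}"

definition mub_state :: "nat \<Rightarrow> complex mat \<Rightarrow> nat \<Rightarrow> nat \<Rightarrow> complex vec" where
  "mub_state d W r s = (1 / of_nat d) \<cdot>\<^sub>v finsum_vec TYPE(complex) (d * d)
     (\<lambda>k. ((omega d ^ s) ^ (d - k) * (omega d powi (- int r)) ^ alpha d k) \<cdot>\<^sub>v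
          vec_of_op d (W ^\<^sub>m k)) {..<d}"

end

theory Submission
  imports Defs
begin

text \<open>In suitable coordinates everything reduces to the autocorrelation of the quadratic chirp
  \<open>c k = \<omega> ^ (u * k * (k - 1) / 2 + t * k)\<close>, which is \<open>d\<close>-periodic because \<open>d\<close> is odd: for
  \<open>\<not> d dvd u\<close> the sum over \<open>l\<close> of \<open>c (l + m) * cnj (c l)\<close> vanishes for \<open>0 < m < d\<close> and is \<open>d\<close> for \<open>m = 0\<close>.
  The adjoint of \<open>W ^ l\<close> times \<open>W ^ k\<close> is \<open>W ^ ((k - l) mod d)\<close>, of trace \<open>0\<close> unless \<open>k = l\<close>; hence the \<open>|W ^ k\<rangle>\<close>
  are orthogonal. Modulo \<open>d\<close>, \<open>alpha d k\<close> is \<open>- k * (k - 1) / 2\<close>, so \<open>mub_state d W r s\<close> has the coefficients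
  \<open>c k / sqrt d\<close> with \<open>u = r\<close>, \<open>t = - s\<close> in the basis \<open>power_state d W\<close>. Two such bases are unbiased
  because the inner products are Gauss sums (the autocorrelation summed over \<open>m\<close>), and the vectors are
  maximally entangled because weighting the autocorrelation with \<open>W ^ m\<close> shows the
  operator with vectorisation \<open>sqrt d * mub_state d W r s\<close> to be unitary.\<close>

section \<open>Additive characters of the integers modulo \<open>d\<close>\<close>

definition chi :: "nat \<Rightarrow> int \<Rightarrow> complex" where
  "chi d t = cis (2 * pi * of_int t / of_nat d)"

lemma chi_add: "chi d (x + y) = chi d x * chi d y"
  by (simp add: chi_def cis_mult add_divide_distrib distrib_left)

lemma chi_0 [simp]: "chi d 0 = 1"
  by (simp add: chi_def)

lemma cnj_chi [simp]: "cnj (chi d x) = chi d (- x)"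
  by (simp add: chi_def cis_cnj)

lemma cmod_chi [simp]: "cmod (chi d x) = 1"
  by (simp add: chi_def)

lemma omega_powi: "omega d powi t = chi d t"
proof -
  have "omega d = cis (2 * pi / of_nat d)"
    by (simp add: omega_def cis_conv_exp mult_ac)
  then show ?thesis
    by (simp add: chi_def cis_power_int mult_ac)
qed

lemma omega_power: "omega d ^ n = chi d (int n)"
  using omega_powi[of d "int n"] by simp

lemma chi_power: "chi d t ^ n = chi d (t * int n)"
  by (simp add: chi_def DeMoivre mult_ac)

lemma chi_eq_1_iff:
  assumes "d > 0"
  shows "chi d t = 1 \<longleftrightarrow> int d dvd t"
proof
  assume "chi d t = 1"
  \<comment> \<open>The real part suffices, since the cosine is 1 only at integer multiples of
    \<open>2 * pi\<close>.\<close>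
  then have "cos (2 * pi * of_int t / of_nat d) = 1"
    by (simp add: chi_def complex_eq_iff)
  then obtain n :: int where "2 * pi * of_int t / of_nat d = of_int n * 2 * pi"
    using cos_one_2pi_int by auto
  then have "real_of_int t = of_int (n * int d)"
    using assms by (simp add: field_simps)
  then have "t = n * int d"
    by linarith
  then show "int d dvd t" by simp
next
  assume "int d dvd t"
  then obtain n where "t = int d * n" by auto
  then have "2 * pi * of_int t / of_nat d = 2 * pi * of_int n"
    using assms by simp
  then show "chi d t = 1"
    by (simp only: chi_def) (simp add: cis_multiple_2pi)
qed

lemma chi_cong:
  assumes "d > 0" and "int d dvd x - y"
  shows "chi d x = chi d y"
  using chi_add[of d "x - y" y] chi_eq_1_iff[of d "x - y"] assms by simp

text \<open>A geometric sum: \<open>chi d t\<close> is a \<open>d\<close>-th root of unity, and it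
  differs from 1 exactly when \<open>d\<close> does not divide \<open>t\<close>.\<close>

lemma sum_chi:
  assumes "d > 0"
  shows "(\<Sum>k<d. chi d (t * int k)) = (if int d dvd t then of_nat d else 0)"
proof (cases "int d dvd t")
  case True
  then have "chi d (t * int k) = 1" for k
    using assms by (simp add: chi_eq_1_iff)
  then show ?thesis using True by simp
next
  case False
  have "chi d t ^ d = 1"
    using assms by (simp add: chi_power chi_eq_1_iff)
  moreover have "chi d t \<noteq> 1"
    using False assms by (simp add: chi_eq_1_iff)
  ultimately have "(\<Sum>k<d. chi d t ^ k) = 0"
    by (simp add: geometric_sum)
  then show ?thesis
    using False by (simp add: chi_power)
qed

section \<open>Quadratic chirps and Gauss sums\<close>

text \<open>The inverse of \<open>2\<close> modulo an odd \<open>d\<close>, which lets quadratic exponents avoid integer division.\<close>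

definition half :: "nat \<Rightarrow> int" where
  "half d = (int d + 1) div 2"

lemma two_half:
  assumes "odd d"
  shows "2 * half d = int d + 1"
  using assms unfolding half_def by presburger

lemma dvd_double_imp_dvd:
  assumes "odd d" and "int d dvd 2 * x"
  shows "int d dvd x"
proof -
  have "coprime (int d) 2" using assms(1) by simp
  then show ?thesis using assms(2) coprime_dvd_mult_right_iff by blast
qed

text \<open>The parameters are integers, so negative slopes and differences of curvatures stay
  inside the family.\<close>

definition chirp :: "nat \<Rightarrow> int \<Rightarrow> int \<Rightarrow> int \<Rightarrow> complex" where
  "chirp d u t k = chi d (u * half d * (k * (k - 1)) + t * k)"

lemma cmod_chirp [simp]: "cmod (chirp d u t k) = 1"
  by (simp add: chirp_def)

lemma chirp_cnj_mult: "cnj (chirp d u t k) * chirp d u' t' k = chirp d (u' - u) (t' - t) k"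
  unfolding chirp_def by (simp add: chi_add[symmetric] algebra_simps)

text \<open>Replacing \<open>x\<close> by \<open>x + d * q\<close> changes
  \<open>x * (x - 1)\<close> by \<open>d * q * (2 * x - 1 + d * q)\<close>; as \<open>half d\<close>
  is an integer, the exponent changes by a multiple of \<open>d\<close>.\<close>

lemma chirp_mod:
  assumes "d > 0"
  shows "chirp d u t (x mod int d) = chirp d u t x"
proof -
  have "int d dvd x mod int d - x"
    by (simp add: mod_eq_dvd_iff[symmetric])
  then obtain q where q: "x mod int d = x + int d * q"
    by (metis add.commute diff_add_cancel dvdE)
  show ?thesis
    unfolding chirp_def q
    by (rule chi_cong[OF assms], rule dvdI[of _ _ "u * half d * q * (2 * x - 1 + int d * q) + t * q"])
       (simp add: algebra_simps)
qed

text \<open>Differencing a quadratic phase leaves a linear one: the cross term of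
  \<open>(m + l) * (m + l - 1)\<close> is \<open>2 * m * l\<close>, and \<open>2 * half d\<close> is
  1 modulo \<open>d\<close>. As a function of \<open>l\<close> the product is a constant times a
  character.\<close>

lemma chirp_shift:
  assumes "odd d"
  shows "chirp d u t (m + l) * cnj (chirp d u t l) = chirp d u t m * chi d (u * m * l)"
proof -
  have "d > 0" using assms by (rule odd_pos)
  have "2 * half d * (u * m * l) = u * m * l + int d * (u * m * l)"
    unfolding two_half[OF assms] by (simp add: algebra_simps)
  then show ?thesis
    unfolding chirp_def cnj_chi chi_add[symmetric]
    by (intro chi_cong[OF \<open>d > 0\<close>] dvdI[of _ _ "u * m * l"]) (simp add: algebra_simps)
qed

text \<open>Adding \<open>d\<close> before subtracting \<open>l\<close> avoids truncation, so the
  second fact inverts the cyclic shift and yields its injectivity.\<close>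

lemma bij_betw_shift_mod:
  assumes "(l::nat) < d"
  shows "bij_betw (\<lambda>m. (m + l) mod d) {..<d} {..<d}"
    and "\<And>m. m < d \<Longrightarrow> ((m + l) mod d + d - l) mod d = m"
proof -
  show *: "((m + l) mod d + d - l) mod d = m" if "m < d" for m
  proof (cases "m + l < d")
    case False
    then have "(m + l) mod d = m + l - d"
      using that assms by (simp add: mod_if)
    then show ?thesis using that assms False by simp
  qed (use that assms in simp)
  have "inj_on (\<lambda>m. (m + l) mod d) {..<d}"
    by (rule inj_on_inverseI[of _ "\<lambda>k. (k + d - l) mod d"]) (simp add: *)
  moreover have "(\<lambda>m. (m + l) mod d) ` {..<d} \<subseteq> {..<d}"
    using assms by auto
  ultimately show "bij_betw (\<lambda>m. (m + l) mod d) {..<d} {..<d}"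
    by (simp add: bij_betw_def endo_inj_surj)
qed

text \<open>Substituting \<open>(m + l) mod d\<close> for \<open>k\<close> turns the sum over
  \<open>l\<close> into a character sum with parameter \<open>u * m\<close>. The weight
  \<open>F\<close> is left arbitrary: the constant 1 gives the modulus of Gauss sums, the entries of
  \<open>W ^\<^sub>m m\<close> give unitarity.\<close>

lemma chirp_autocorrelation:
  assumes "prime d" and "d > 2" and u: "\<not> int d dvd u"
  shows "(\<Sum>k<d. \<Sum>l<d. chirp d u t (int k) * cnj (chirp d u t (int l)) * F ((k + d - l) mod d))
    = of_nat d * F 0"
proof -
  have odd: "odd d" and pos: "d > 0"
    using prime_odd_nat[OF assms(1,2)] assms(2) by auto
  have inner: "(\<Sum>k<d. chirp d u t (int k) * cnj (chirp d u t (int l)) * F ((k + d - l) mod d))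
    = (\<Sum>m<d. chirp d u t (int m) * F m * chi d (u * int m * int l))" if "l < d" for l
  proof -
    have "(\<Sum>k<d. chirp d u t (int k) * cnj (chirp d u t (int l)) * F ((k + d - l) mod d))
      = (\<Sum>m<d. chirp d u t (int ((m + l) mod d)) * cnj (chirp d u t (int l))
          * F (((m + l) mod d + d - l) mod d))"
      by (rule sum.reindex_bij_betw[symmetric, OF bij_betw_shift_mod(1)[OF that]])
    also have "\<dots> = (\<Sum>m<d. chirp d u t (int m) * F m * chi d (u * int m * int l))"
      by (rule sum.cong)
        (simp_all add: bij_betw_shift_mod(2)[OF that] zmod_int chirp_mod[OF pos]
          chirp_shift[OF odd] del: cnj_chi)
    finally show ?thesis .
  qed
  \<comment> \<open>Since \<open>d\<close> is prime, \<open>u\<close> is invertible modulo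
    \<open>d\<close>, so only \<open>m = 0\<close> survives.\<close>
  have nd: "int d dvd u * int m \<longleftrightarrow> m = 0" if "m < d" for m
  proof -
    have "prime (int d)" using assms(1) by simp
    then have "int d dvd u * int m \<longleftrightarrow> int d dvd int m"
      using u by (simp add: prime_dvd_mult_iff)
    also have "\<dots> \<longleftrightarrow> m = 0"
      using that nat_dvd_not_less by auto
    finally show ?thesis .
  qed
  have "(\<Sum>k<d. \<Sum>l<d. chirp d u t (int k) * cnj (chirp d u t (int l)) * F ((k + d - l) mod d))
    = (\<Sum>l<d. \<Sum>m<d. chirp d u t (int m) * F m * chi d (u * int m * int l))"
    by (subst sum.swap) (simp add: inner)
  also have "\<dots> = (\<Sum>m<d. chirp d u t (int m) * F m * (\<Sum>l<d. chi d (u * int m * int l)))"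
    by (subst sum.swap) (simp add: sum_distrib_left)
  also have "\<dots> = (\<Sum>m<d. if m = 0 then of_nat d * F 0 else 0)"
    by (rule sum.cong) (auto simp: sum_chi[OF pos] nd chirp_def)
  finally show ?thesis using pos by simp
qed

text \<open>The squared modulus is the double sum of \<open>chirp_autocorrelation\<close> with
  constant weight 1.\<close>

lemma gauss_sum_cmod:
  assumes "prime d" and "d > 2" and "\<not> int d dvd u"
  shows "cmod (\<Sum>k<d. chirp d u t (int k)) = sqrt (of_nat d)"
proof -
  let ?G = "\<Sum>k<d. chirp d u t (int k)"
  have "?G * cnj ?G = of_nat d"
    using chirp_autocorrelation[OF assms, of t "\<lambda>_. 1"]
    by (simp add: sum_product)
  then have "of_real ((cmod ?G)\<^sup>2) = (of_real (of_nat d) :: complex)"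
    by (simp only: complex_norm_square) simp
  then have "(cmod ?G)\<^sup>2 = of_nat d"
    by (simp only: of_real_eq_iff)
  then show ?thesis
    by (metis norm_ge_zero real_sqrt_unique)
qed

text \<open>In \<open>alpha d k = d * (d - 1) / 2 - k * (k - 1) / 2\<close> the first part is a
  multiple of \<open>d\<close> because \<open>d\<close> is odd, and so is the summand
  \<open>s * d\<close> of the exponent \<open>s * (d - k)\<close>.\<close>

lemma mub_coefficient:
  assumes "odd d" and "k < d"
  shows "(omega d ^ s) ^ (d - k) * (omega d powi (- int r)) ^ alpha d k
    = chirp d (int r) (- int s) (int k)"
proof -
  have "d > 0" using assms(1) by (rule odd_pos)
  \<comment> \<open>Doubling avoids division; the factor 2 is cancelled below because
    \<open>d\<close> is odd. The induction raises \<open>d\<close> from \<open>k\<close>, where the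
    sum is empty.\<close>
  have "2 * int (\<Sum>{k..<d}) = int d * (int d - 1) - int k * (int k - 1)"
    using assms(2)[THEN less_imp_le] by (induction d rule: dec_induct) (simp_all add: algebra_simps)
  then have "2 * (int (alpha d k) + half d * (int k * (int k - 1)))
      = int d * (int d - 1) - int k * (int k - 1) + (2 * half d) * (int k * (int k - 1))"
    by (simp add: alpha_def)
  then have "int d dvd 2 * (int (alpha d k) + half d * (int k * (int k - 1)))"
    unfolding two_half[OF assms(1)]
    by (intro dvdI[of _ _ "int d - 1 + int k * (int k - 1)"]) (simp add: algebra_simps)
  then have "int d dvd int (alpha d k) + half d * (int k * (int k - 1))"
    by (rule dvd_double_imp_dvd[OF assms(1)])
  then obtain q where q: "int (alpha d k) = int d * q - half d * (int k * (int k - 1))"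
    by (metis add_diff_cancel_right' dvdE)
  show ?thesis
    unfolding omega_power omega_powi chi_power chi_add[symmetric] chirp_def q
    using assms(2) \<open>d > 0\<close>
    by (intro chi_cong dvdI[of _ _ "int s - int r * q"]) (simp_all add: of_nat_diff algebra_simps)
qed

section \<open>Vectorised operators and maximal entanglement\<close>

lemma vec_of_op_carrier [simp]: "vec_of_op d U \<in> carrier_vec (d * d)"
  unfolding vec_of_op_def
  by (rule finsum_vec_closed) (auto simp: tensor_vec_def)

lemma vec_of_op_dim [simp]: "dim_vec (vec_of_op d U) = d * d"
  using vec_of_op_carrier[of d U] by simp

text \<open>Position \<open>m * d + n\<close> receives only the summand of the pair
  \<open>(m, n)\<close>, so vectorisation stacks the columns of \<open>U\<close>.\<close>

lemma vec_of_op_index: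
  assumes "i < d * d"
  shows "vec_of_op d U $ i = U $$ (i mod d, i div d)"
proof -
  have "d > 0" using assms by (cases d) auto
  then have "i mod d < d" and "i div d < d"
    using assms by (auto simp: div_less_iff_less_mult)
  let ?f = "\<lambda>(m, n). U $$ (n, m) \<cdot>\<^sub>v tensor_vec d (unit_vec d m) (unit_vec d n)"
  have "vec_of_op d U $ i = (\<Sum>p\<in>{..<d} \<times> {..<d}. ?f p $ i)"
    unfolding vec_of_op_def
    by (rule index_finsum_vec) (auto simp: assms tensor_vec_def)
  also have "\<dots> = (\<Sum>p\<in>{..<d} \<times> {..<d}.
      if p = (i div d, i mod d) then U $$ (i mod d, i div d) else 0)"
    by (rule sum.cong)
      (auto simp: assms tensor_vec_def \<open>i mod d < d\<close> \<open>i div d < d\<close> split: if_splits)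
  finally show ?thesis
    using \<open>i mod d < d\<close> \<open>i div d < d\<close> by simp
qed

lemma sum_div_mod:
  "(\<Sum>i<d * d. f (i mod d) (i div d)) = (\<Sum>m<d. \<Sum>n<d. f n m)" for d :: nat
proof -
  have "(\<Sum>i<d * d. f (i mod d) (i div d)) = (\<Sum>m<d. \<Sum>i\<in>{m * d..<m * d + d}. f (i mod d) (i div d))"
    by (rule sum.nat_group[symmetric])
  also have "\<dots> = (\<Sum>m<d. \<Sum>n<d. f n m)"
  proof (rule sum.cong)
    fix m
    have "(\<Sum>i\<in>{m * d..<m * d + d}. f (i mod d) (i div d)) = (\<Sum>n\<in>{0..<d}. f ((n + m * d) mod d) ((n + m * d) div d))"
      using sum.shift_bounds_nat_ivl[of "\<lambda>i. f (i mod d) (i div d)" 0 "m * d" d] by (simp add: add.commute)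
    also have "\<dots> = (\<Sum>n<d. f n m)"
      by (rule sum.cong) auto
    finally show "(\<Sum>i\<in>{m * d..<m * d + d}. f (i mod d) (i div d)) = (\<Sum>n<d. f n m)" .
  qed simp
  finally show ?thesis .
qed

lemma braket_sum:
  assumes "u \<in> carrier_vec N"
  shows "braket u v = (\<Sum>i<N. cnj (u $ i) * v $ i)"
  using assms by (auto simp: braket_def scalar_prod_def atLeast0LessThan mult.commute intro!: sum.cong)

text \<open>For a square matrix \<open>A\<close>, if its adjoint times \<open>A\<close> is the
  identity over \<open>d\<close>, then so is \<open>A\<close> times its adjoint. The latter product
  is the partial trace over the first factor; the former is, up to transposition, the one over the
  second, and its trace is the squared norm.\<close>

lemma maximally_entangledI:
  assumes d: "d > 0"
    and v: "v \<in> carrier_vec (d * d)"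
    and index: "\<And>i. i < d * d \<Longrightarrow> v $ i = A (i mod d) (i div d)"
    and isometry: "\<And>i j. i < d \<Longrightarrow> j < d \<Longrightarrow>
      (\<Sum>k<d. cnj (A k i) * A k j) = (if i = j then 1 / of_nat d else 0)"
  shows "maximally_entangled d v"
proof -
  let ?M = "mat d d (\<lambda>(i, j). A i j)"
  \<comment> \<open>The adjoint scaled by \<open>d\<close> is a left inverse of \<open>?M\<close>
    and hence, both being square, a right inverse.\<close>
  let ?N = "mat d d (\<lambda>(i, j). of_nat d * cnj (A j i))"
  have "?N * ?M = 1\<^sub>m d"
    using d isometry
    by (intro eq_matI) (simp_all add: scalar_prod_def atLeast0LessThan mult.assoc sum_distrib_left[symmetric])
  then have "?M * ?N = 1\<^sub>m d"
    by (rule mat_mult_left_right_inverse[rotated 2]) simp_all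
  have *: "of_nat d * (\<Sum>k<d. A i k * cnj (A j k)) = (if i = j then 1 else 0)" if "i < d" "j < d" for i j
    using \<open>?M * ?N = 1\<^sub>m d\<close>[THEN arg_cong, of "\<lambda>X. X $$ (i, j)"] that
    by (simp add: scalar_prod_def atLeast0LessThan sum_distrib_left mult.left_commute)
  have coisometry: "(\<Sum>k<d. A i k * cnj (A j k)) = (if i = j then 1 / of_nat d else 0)"
    if "i < d" "j < d" for i j
    using *[OF that] d by (simp add: eq_divide_eq mult.commute split: if_splits)
  have isometry': "(\<Sum>k<d. A k i * cnj (A k j)) = (if i = j then 1 / of_nat d else 0)"
    if "i < d" "j < d" for i j
    using isometry[OF that(2,1)] by (simp add: mult.commute)
  have lt: "k * d + i < d * d" if "k < d" "i < d" for k i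
  proof -
    have "k * d + i < Suc k * d" using that by simp
    also have "\<dots> \<le> d * d" using that by (intro mult_le_mono1) simp
    finally show ?thesis .
  qed
  have proj: "projector v $$ (k * d + i, l * d + j) = A i k * cnj (A j l)"
    if "i < d" "j < d" "k < d" "l < d" for i j k l
    using that v lt by (simp add: projector_def index)
  have "braket v v = (\<Sum>i<d * d. cnj (A (i mod d) (i div d)) * A (i mod d) (i div d))"
    using v by (simp add: braket_sum index)
  also have "\<dots> = (\<Sum>m<d. \<Sum>n<d. cnj (A n m) * A n m)"
    by (rule sum_div_mod)
  also have "\<dots> = 1"
    using d by (simp add: isometry)
  finally have "braket v v = 1" .
  moreover have "partial_trace_1 d (projector v) = (1 / of_nat d) \<cdot>\<^sub>m 1\<^sub>m d"
    by (rule eq_matI) (auto simp: partial_trace_1_def proj coisometry)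
  moreover have "partial_trace_2 d (projector v) = (1 / of_nat d) \<cdot>\<^sub>m 1\<^sub>m d"
    by (rule eq_matI) (auto simp: partial_trace_2_def proj isometry')
  ultimately show ?thesis
    using v by (simp add: maximally_entangled_def)
qed

section \<open>Entries, products and traces of the powers of \<open>W\<close>\<close>

lemma index_mult_mat_sum:
  assumes "A \<in> carrier_mat n m" "B \<in> carrier_mat m p" "i < n" "j < p"
  shows "(A * B) $$ (i, j) = (\<Sum>k<m. A $$ (i, k) * B $$ (k, j))"
  using assms by (auto simp: scalar_prod_def atLeast0LessThan)

lemma pauli_X_carrier [simp]: "pauli_X d \<in> carrier_mat d d"
  by (simp add: pauli_X_def)

lemma pauli_Z_carrier [simp]: "pauli_Z d \<in> carrier_mat d d"
  by (simp add: pauli_Z_def)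

lemma pauli_X_power_index:
  assumes "i < d" "j < d"
  shows "(pauli_X d ^\<^sub>m b) $$ (i, j) = (if i = (j + b) mod d then 1 else 0)"
  using assms
proof (induction b arbitrary: i j)
  case (Suc b)
  have X: "pauli_X d \<in> carrier_mat d d"
    by (simp add: pauli_X_def)
  have "(pauli_X d ^\<^sub>m Suc b) $$ (i, j) = (\<Sum>k<d. (pauli_X d ^\<^sub>m b) $$ (i, k) * pauli_X d $$ (k, j))"
    using index_mult_mat_sum[OF pow_carrier_mat[OF X] X Suc.prems] by simp
  also have "\<dots> = (\<Sum>k<d. if k = (j + 1) mod d then (if i = (k + b) mod d then 1 else 0) else 0)"
    using Suc by (intro sum.cong) (auto simp: pauli_X_def)
  also have "\<dots> = (if i = (j + Suc b) mod d then 1 else 0)"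
    using Suc.prems by (simp add: mod_simps)
  finally show ?case .
qed (auto simp: pauli_X_def)

lemma pauli_Z_power_index:
  assumes "i < d" "j < d"
  shows "(pauli_Z d ^\<^sub>m a) $$ (i, j) = (if i = j then chi d (int a * int j) else 0)"
  using assms
proof (induction a arbitrary: i j)
  case (Suc a)
  have Z: "pauli_Z d \<in> carrier_mat d d"
    by (simp add: pauli_Z_def)
  have "(pauli_Z d ^\<^sub>m Suc a) $$ (i, j) = (\<Sum>k<d. (pauli_Z d ^\<^sub>m a) $$ (i, k) * pauli_Z d $$ (k, j))"
    using index_mult_mat_sum[OF pow_carrier_mat[OF Z] Z Suc.prems] by simp
  also have "\<dots> = (\<Sum>k<d. if k = j then (if i = k then chi d (int a * int k) * chi d (int j) else 0) else 0)"
    using Suc by (intro sum.cong) (auto simp: pauli_Z_def omega_power)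
  also have "\<dots> = (if i = j then chi d (int (Suc a) * int j) else 0)"
    using Suc.prems by (simp add: chi_add[symmetric] algebra_simps)
  finally show ?case .
qed (auto simp: pauli_Z_def)

lemma weyl_carrier [intro]: "pauli_X d ^\<^sub>m b * pauli_Z d ^\<^sub>m a \<in> carrier_mat d d"
  by (rule mult_carrier_mat[OF pow_carrier_mat pow_carrier_mat]) simp_all

lemma weyl_dim [simp]:
  "dim_row (pauli_X d ^\<^sub>m b * pauli_Z d ^\<^sub>m a) = d"
  "dim_col (pauli_X d ^\<^sub>m b * pauli_Z d ^\<^sub>m a) = d"
  using weyl_carrier[of d b a] by (simp_all only: carrier_mat_def mem_Collect_eq)

lemma weyl_index:
  assumes "i < d" "j < d"
  shows "(pauli_X d ^\<^sub>m b * pauli_Z d ^\<^sub>m a) $$ (i, j) =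
    (if i = (j + b) mod d then chi d (int a * int j) else 0)"
proof -
  have X: "pauli_X d ^\<^sub>m b \<in> carrier_mat d d" and Z: "pauli_Z d ^\<^sub>m a \<in> carrier_mat d d"
    by (simp_all add: pow_carrier_mat)
  have "(pauli_X d ^\<^sub>m b * pauli_Z d ^\<^sub>m a) $$ (i, j)
    = (\<Sum>k<d. (pauli_X d ^\<^sub>m b) $$ (i, k) * (pauli_Z d ^\<^sub>m a) $$ (k, j))"
    using index_mult_mat_sum[OF X Z assms] by simp
  also have "\<dots> = (\<Sum>k<d. if k = j then (if i = (j + b) mod d then chi d (int a * int j) else 0) else 0)"
    using assms by (intro sum.cong) (auto simp: pauli_X_power_index pauli_Z_power_index)
  finally show ?thesis
    using assms by simp
qed

text \<open>Applying \<open>W\<close> repeatedly to basis vector \<open>j\<close> visits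
  \<open>j\<close>, \<open>j + b\<close>, \<open>j + 2 * b\<close> and so on, collecting phases with
  exponents \<open>a * (j + l * b)\<close> for \<open>l < k\<close>; these sum to
  \<open>a * j * k + a * b * k * (k - 1) / 2\<close>.\<close>

lemma weyl_power_index:
  assumes "odd d" and W: "W = pauli_X d ^\<^sub>m b * pauli_Z d ^\<^sub>m a" and "i < d" "j < d"
  shows "(W ^\<^sub>m k) $$ (i, j) =
    (if i = (j + k * b) mod d then chirp d (int a * int b) (int a * int j) (int k) else 0)"
  using assms(3,4)
proof (induction k arbitrary: i j)
  case 0
  have "W \<in> carrier_mat d d" using W weyl_carrier by simp
  with 0 show ?case by (simp add: chirp_def)
next
  case (Suc k)
  have "d > 0" using assms(1) by (rule odd_pos)
  \<comment> \<open>The rightmost factor moves column \<open>j\<close> to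
    \<open>(j + b) mod d\<close>. The slope thereby grows by \<open>a * b\<close>, which matches the
    increment of the quadratic part; \<open>q\<close> records the reduction modulo
    \<open>d\<close>.\<close>
  have step: "chirp d (int a * int b) (int a * int ((j + b) mod d)) (int k) * chi d (int a * int j)
    = chirp d (int a * int b) (int a * int j) (int (Suc k))"
  proof -
    have "int d dvd int ((j + b) mod d) - (int j + int b)"
      by (simp add: zmod_int mod_eq_dvd_iff[symmetric])
    then obtain q where "int ((j + b) mod d) - (int j + int b) = int d * q" ..
    then have q: "int ((j + b) mod d) = int j + int b + int d * q"
      by simp
    have "2 * half d * (int a * int b * int k) = (int d + 1) * (int a * int b * int k)"
      by (simp add: two_half[OF assms(1)])
    then show ?thesis
      unfolding chirp_def q chi_add[symmetric]
      by (intro chi_cong[OF \<open>d > 0\<close>] dvdI[of _ _ "int a * int k * q - int a * int b * int k"])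
        (simp add: algebra_simps)
  qed
  have carrier: "W \<in> carrier_mat d d"
    using W weyl_carrier by simp
  have "(W ^\<^sub>m Suc k) $$ (i, j) = (\<Sum>l<d. (W ^\<^sub>m k) $$ (i, l) * W $$ (l, j))"
    using index_mult_mat_sum[OF pow_carrier_mat[OF carrier] carrier Suc.prems] by simp
  also have "\<dots> = (\<Sum>l<d. if l = (j + b) mod d then (if i = (l + k * b) mod d then
      chirp d (int a * int b) (int a * int l) (int k) * chi d (int a * int j) else 0) else 0)"
    using Suc weyl_index[of _ d _ b a] by (intro sum.cong) (auto simp: W)
  also have "\<dots> = (if i = (j + Suc k * b) mod d then
      chirp d (int a * int b) (int a * int j) (int (Suc k)) else 0)"
    using \<open>d > 0\<close> step by (simp add: mod_simps add_ac)
  finally show ?case .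
qed

text \<open>\<open>W\<close> is unitary and, for odd \<open>d\<close>, its \<open>d\<close>-th power
  is the identity, so exponents matter only modulo \<open>d\<close>. Each column of a power has a
  single nonzero entry; hence at most one \<open>n\<close> contributes, and positions and phases are
  compared separately.\<close>

lemma weyl_power_adjoint_mult:
  assumes "odd d" and W: "W = pauli_X d ^\<^sub>m b * pauli_Z d ^\<^sub>m a"
    and "i < d" "j < d" "l < d" "k < d"
  shows "(\<Sum>n<d. cnj ((W ^\<^sub>m l) $$ (n, i)) * (W ^\<^sub>m k) $$ (n, j)) = (W ^\<^sub>m ((k + d - l) mod d)) $$ (i, j)"
proof -
  have "d > 0" using assms(1) by (rule odd_pos)
  let ?m = "(k + d - l) mod d"
  have "int d dvd int ?m - (int k - int l)"
  proof -
    have "int ?m = (int k - int l + int d) mod int d"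
      using assms(5) by (simp add: of_nat_diff zmod_int algebra_simps)
    then show ?thesis
      by (simp add: mod_eq_dvd_iff[symmetric])
  qed
  then obtain q where "int ?m - (int k - int l) = int d * q" ..
  then have q: "int ?m = int k - int l + int d * q"
    by simp
  \<comment> \<open>Positions: subtracting the multiple \<open>d * (b * q)\<close> replaces
    \<open>k - l\<close> by the reduced exponent \<open>?m\<close>.\<close>
  have "(i + l * b) mod d = (j + k * b) mod d \<longleftrightarrow> int d dvd int (i + l * b) - int (j + k * b)"
    by (simp add: mod_eq_dvd_iff[symmetric] of_nat_mod[symmetric] del: of_nat_add of_nat_mult)
  also have "\<dots> \<longleftrightarrow> int d dvd (int (i + l * b) - int (j + k * b)) - int d * (int b * q)"
    by (simp add: dvd_diff_left_iff)
  also have "(int (i + l * b) - int (j + k * b)) - int d * (int b * q) = int i - int (j + ?m * b)"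
    unfolding of_nat_add of_nat_mult q by (simp add: algebra_simps)
  also have "int d dvd int i - int (j + ?m * b) \<longleftrightarrow> i mod d = (j + ?m * b) mod d"
    by (simp add: mod_eq_dvd_iff[symmetric] of_nat_mod[symmetric] del: of_nat_add of_nat_mult)
  finally have shift: "(i + l * b) mod d = (j + k * b) mod d \<longleftrightarrow> i = (j + ?m * b) mod d"
    using assms(3) by simp
  have phase: "cnj (chirp d (int a * int b) (int a * int i) (int l)) * chirp d (int a * int b) (int a * int j) (int k)
    = chirp d (int a * int b) (int a * int j) (int ?m)" if "i = (j + ?m * b) mod d"
  proof -
    have "int i = (int j + int ?m * int b) mod int d"
      using that by (simp add: of_nat_mod)
    then have "int d dvd int i - (int j + int ?m * int b)"
      by (metis mod_eq_dvd_iff mod_mod_trivial)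
    then obtain p' where "int i - (int j + int ?m * int b) = int d * p'" ..
    moreover define p where "p = p' + q * int b"
    ultimately have p: "int i = int j + (int k - int l) * int b + int d * p"
      unfolding q by (simp add: algebra_simps)
    \<comment> \<open>The cross term \<open>2 * (k - l) * l\<close> of the quadratic exponents comes
      with \<open>half d\<close>, and \<open>2 * half d\<close> is 1 modulo \<open>d\<close>; it
      then cancels against the change of slope from \<open>j\<close> to \<open>i\<close>.\<close>
    have h: "2 * half d * (int a * int b * (int k - int l) * int l) = (int d + 1) * (int a * int b * (int k - int l) * int l)"
      by (simp add: two_half[OF assms(1)])
    have "chirp d (int a * int b) (int a * int j) (int ?m) = chirp d (int a * int b) (int a * int j) (int k - int l)"
      using chirp_mod[OF \<open>d > 0\<close>] q by (metis mod_mult_self2)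
    also have "\<dots> = cnj (chirp d (int a * int b) (int a * int i) (int l)) * chirp d (int a * int b) (int a * int j) (int k)"
      unfolding chirp_def cnj_chi chi_add[symmetric] p
      using h
      by (intro chi_cong[OF \<open>d > 0\<close>] dvdI[of _ _ "int a * p * int l - int a * int b * (int k - int l) * int l"])
        (simp add: algebra_simps)
    finally show ?thesis by simp
  qed
  have "(\<Sum>n<d. cnj ((W ^\<^sub>m l) $$ (n, i)) * (W ^\<^sub>m k) $$ (n, j))
    = (\<Sum>n<d. if n = (j + k * b) mod d then (if (i + l * b) mod d = (j + k * b) mod d then
        cnj (chirp d (int a * int b) (int a * int i) (int l)) * chirp d (int a * int b) (int a * int j) (int k) else 0) else 0)"
    using assms(3-) by (intro sum.cong) (auto simp: weyl_power_index[OF assms(1,2)])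
  also have "\<dots> = (W ^\<^sub>m ?m) $$ (i, j)"
    using \<open>d > 0\<close> phase assms(3,4) by (simp add: shift weyl_power_index[OF assms(1,2)])
  finally show ?thesis .
qed

text \<open>For \<open>m > 0\<close> and \<open>b\<close> nonzero, \<open>m * b\<close> is a nonzero
  shift modulo the prime \<open>d\<close>, so the diagonal vanishes; if \<open>b = 0\<close>, then
  \<open>a\<close> is nonzero and the diagonal is a nontrivial character. For
  \<open>a = b = 0\<close> every power would be the identity, of trace \<open>d\<close>.\<close>

lemma weyl_power_trace:
  assumes "prime d" "d > 2" and "a < d" "b < d" "(a, b) \<noteq> (0, 0)"
    and W: "W = pauli_X d ^\<^sub>m b * pauli_Z d ^\<^sub>m a" and "m < d"
  shows "(\<Sum>i<d. (W ^\<^sub>m m) $$ (i, i)) = (if m = 0 then of_nat d else 0)"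
proof -
  have odd: "odd d" and "d > 0"
    using prime_odd_nat[OF assms(1,2)] assms(2) by auto
  have ndvd: "d dvd m * c \<longleftrightarrow> m = 0 \<or> c = 0" if "c < d" for c
    using assms(1,7) that nat_dvd_not_less by (auto simp: prime_dvd_mult_iff)
  show ?thesis
  proof (cases "m = 0 \<or> b \<noteq> 0")
    case True
    have "(W ^\<^sub>m m) $$ (i, i) = (if m = 0 then 1 else 0)" if "i < d" for i
    proof (cases "m = 0")
      case False
      then have "\<not> d dvd m * b" using True ndvd assms(4) by simp
      then have "i \<noteq> (i + m * b) mod d"
        using that by (metis add_diff_cancel_left' le_add1 mod_eq_dvd_iff_nat mod_less)
      then show ?thesis
        using that False by (simp add: weyl_power_index[OF odd W])
    qed (use that weyl_dim[of d b a] in \<open>simp add: W\<close>)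
    then show ?thesis by simp
  next
    case False
    then have "\<not> int d dvd int a * int m"
      using ndvd[OF assms(3)] assms(5) by (metis mult.commute of_nat_dvd_iff of_nat_mult)
    then have "(\<Sum>i<d. chi d (int a * int m * int i)) = 0"
      by (simp add: sum_chi[OF \<open>d > 0\<close>])
    moreover have "(\<Sum>i<d. (W ^\<^sub>m m) $$ (i, i)) = (\<Sum>i<d. chi d (int a * int m * int i))"
      using False by (intro sum.cong) (simp_all add: weyl_power_index[OF odd W] chirp_def mult_ac)
    ultimately show ?thesis using False by simp
  qed
qed

section \<open>Orthonormal bases of subspaces\<close>

lemma orthonormal_inj_on:
  assumes "\<And>i j. i < m \<Longrightarrow> j < m \<Longrightarrow> braket (f i) (f j) = (if i = j then 1 else 0)"
  shows "inj_on f {..<m}"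
  using assms by (auto intro!: inj_onI) (metis one_neq_zero)

lemma orthonormal_lin_indpt:
  fixes m :: nat
  assumes carrier: "\<And>i. i < m \<Longrightarrow> f i \<in> carrier_vec N"
    and orth: "\<And>i j. i < m \<Longrightarrow> j < m \<Longrightarrow> braket (f i) (f j) = (if i = j then 1 else 0)"
  shows "LinearCombinations.module.lin_indpt class_ring (module_vec TYPE(complex) N) (f ` {..<m})"
proof -
  interpret vec_space "TYPE(complex)" N .
  have inj: "inj_on f {..<m}"
    by (rule orthonormal_inj_on[OF orth])
  show ?thesis
  proof (rule finite_lin_indpt2)
    show sub: "f ` {..<m} \<subseteq> carrier_vec N"
      using carrier by auto
    fix c
    assume "lincomb c (f ` {..<m}) = 0\<^sub>v N"
    then have zero: "(\<Sum>v\<in>f ` {..<m}. c v * v $ i) = 0" if "i < N" for i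
      using lincomb_index[OF that, of "f ` {..<m}" c] sub that by simp
    have "c (f j) = 0" if "j < m" for j
    proof -
      have "0 = (\<Sum>i<N. cnj (f j $ i) * (\<Sum>v\<in>f ` {..<m}. c v * v $ i))"
        by (simp add: zero)
      also have "\<dots> = (\<Sum>i<N. cnj (f j $ i) * (\<Sum>l<m. c (f l) * f l $ i))"
        by (simp add: sum.reindex[OF inj])
      also have "\<dots> = (\<Sum>l<m. c (f l) * (\<Sum>i<N. cnj (f j $ i) * f l $ i))"
        unfolding sum_distrib_left by (subst sum.swap) (simp add: mult.left_commute)
      also have "\<dots> = (\<Sum>l<m. if l = j then c (f l) else 0)"
        using orth[OF that] braket_sum[OF carrier[OF that]] by (intro sum.cong) auto
      finally show ?thesis
        using that by simp
    qed
    then show "\<forall>v\<in>f ` {..<m}. c v = 0"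
      by auto
  qed simp
qed

text \<open>Applied to the power states, this supplies the subspace of the theorem and its
  dimension.\<close>

lemma onb_of_span:
  assumes "\<And>i. i < m \<Longrightarrow> f i \<in> carrier_vec N"
    and "\<And>i j. i < m \<Longrightarrow> j < m \<Longrightarrow> braket (f i) (f j) = (if i = j then 1 else 0)"
  defines "S \<equiv> LinearCombinations.module.span class_ring (module_vec TYPE(complex) N) (f ` {..<m})"
  shows "VectorSpace.subspace class_ring S (module_vec TYPE(complex) N)"
    and "onb_of N S m f"
    and "vectorspace.dim class_ring (module_vec TYPE(complex) N\<lparr>carrier := S\<rparr>) = m"
    and "\<And>i. i < m \<Longrightarrow> f i \<in> S"
proof -
  interpret vec_space "TYPE(complex)" N .
  have sub: "f ` {..<m} \<subseteq> carrier_vec N"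
    using assms(1) by auto
  show subspace: "VectorSpace.subspace class_ring S V"
    unfolding S_def using sub by (intro span_is_subspace) simp
  have "f ` {..<m} \<subseteq> S"
    unfolding S_def using sub by (intro in_own_span) simp
  then show "\<And>i. i < m \<Longrightarrow> f i \<in> S"
    by auto
  have submod: "submodule class_ring S V"
    unfolding S_def using sub by (intro span_is_submodule) simp
  interpret S: vectorspace class_ring "vs S"
    by (rule subspace_is_vs[OF subspace])
  \<comment> \<open>Span and independence of a family inside \<open>S\<close> are the same whether
    taken in \<open>S\<close> or in the ambient space.\<close>
  have basis: "S.basis (f ` {..<m})"
    unfolding S.basis_def
    using span_li_not_depend[OF \<open>f ` {..<m} \<subseteq> S\<close> submod] \<open>f ` {..<m} \<subseteq> S\<close>
      orthonormal_lin_indpt[of m f N, OF assms(1,2)]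
    by (simp add: S_def)
  then show "onb_of N S m f"
    using assms(2) by (simp add: onb_of_def)
  show "S.dim = m"
    using S.dim_basis[OF _ basis] card_image[OF orthonormal_inj_on[of m f, OF assms(2)]] by simp
qed

text \<open>Counting replaces a spanning argument: the known basis \<open>g\<close> gives
  \<open>S\<close> dimension \<open>m\<close>, and \<open>m\<close> orthonormal vectors are
  independent.\<close>

lemma onb_of_subspaceI:
  assumes subspace: "VectorSpace.subspace class_ring S (module_vec TYPE(complex) N)"
    and g: "onb_of N S m g"
    and f: "\<And>i. i < m \<Longrightarrow> f i \<in> S"
    and orth: "\<And>i j. i < m \<Longrightarrow> j < m \<Longrightarrow> braket (f i) (f j) = (if i = j then 1 else 0)"
  shows "onb_of N S m f"
proof -
  interpret vec_space "TYPE(complex)" N .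
  interpret S: vectorspace class_ring "vs S"
    by (rule subspace_is_vs[OF subspace])
  have submod: "submodule class_ring S V"
    using subspace by (simp add: subspace_def)
  then have "S \<subseteq> carrier_vec N"
    using submodule.subset by fastforce
  have "f ` {..<m} \<subseteq> S"
    using f by auto
  have g_basis: "S.basis (g ` {..<m})"
    using g by (simp add: onb_of_def)
  have "S.dim = m"
    using S.dim_basis[OF _ g_basis] card_image[OF orthonormal_inj_on[of m g]] g
    by (simp add: onb_of_def)
  moreover have "card (f ` {..<m}) = m"
    using card_image[OF orthonormal_inj_on[of m f, OF orth]] by simp
  moreover have "S.fin_dim"
    using g_basis unfolding S.fin_dim_def S.basis_def by blast
  moreover have "S.lin_indpt (f ` {..<m})"
    using span_li_not_depend(2)[OF \<open>f ` {..<m} \<subseteq> S\<close> submod] f \<open>S \<subseteq> carrier_vec N\<close>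
      orthonormal_lin_indpt[of m f N, OF _ orth] by auto
  ultimately have "S.basis (f ` {..<m})"
    using \<open>f ` {..<m} \<subseteq> S\<close> by (intro S.dim_li_is_basis) auto
  then show ?thesis
    using orth by (simp add: onb_of_def)
qed

lemma finsum_vec_in_span:
  assumes "X \<subseteq> carrier_vec N" and "finite A"
    and "\<And>k. k \<in> A \<Longrightarrow> h k \<in> LinearCombinations.module.span class_ring (module_vec TYPE(complex) N) X"
  shows "finsum_vec TYPE(complex) N h A \<in> LinearCombinations.module.span class_ring (module_vec TYPE(complex) N) X"
  using assms(2,3)
proof (induction A rule: finite_induct)
  case empty
  interpret vec_space "TYPE(complex)" N .
  show ?case using span_zero by (simp add: finsum_vec_empty)
next
  case (insert k A)
  interpret vec_space "TYPE(complex)" N .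
  have "h \<in> insert k A \<rightarrow> carrier_vec N"
    using insert.prems span_is_subset2[OF assms(1)] by auto
  then have "finsum_vec TYPE(complex) N h (insert k A) = h k + finsum_vec TYPE(complex) N h A"
    using insert.hyps by (intro finsum_vec_insert) auto
  then show ?case
    using span_add1[OF assms(1)] insert by simp
qed

text \<open>Orthonormality of \<open>p\<close> reduces inner products in dimension \<open>N\<close>
  to sums over the \<open>m\<close> coefficients.\<close>

lemma braket_combination:
  fixes m :: nat
  assumes p: "\<And>k. k < m \<Longrightarrow> p k \<in> carrier_vec N"
    and orth: "\<And>k l. k < m \<Longrightarrow> l < m \<Longrightarrow> braket (p k) (p l) = (if k = l then 1 else 0)"
    and v: "\<And>i. i < N \<Longrightarrow> v $ i = (\<Sum>k<m. y k * p k $ i)"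
  shows "\<And>k. k < m \<Longrightarrow> braket (p k) v = y k"
    and "u \<in> carrier_vec N \<Longrightarrow> (\<And>i. i < N \<Longrightarrow> u $ i = (\<Sum>k<m. x k * p k $ i))
      \<Longrightarrow> braket u v = (\<Sum>k<m. cnj (x k) * y k)"
proof -
  show coeff: "braket (p k) v = y k" if "k < m" for k
  proof -
    have "braket (p k) v = (\<Sum>i<N. cnj (p k $ i) * (\<Sum>l<m. y l * p l $ i))"
      using p[OF that] by (simp add: braket_sum v)
    also have "\<dots> = (\<Sum>l<m. y l * (\<Sum>i<N. cnj (p k $ i) * p l $ i))"
      unfolding sum_distrib_left by (subst sum.swap) (simp add: mult.left_commute)
    also have "\<dots> = (\<Sum>l<m. if l = k then y l else 0)"
      using orth[OF that] braket_sum[OF p[OF that]] by (intro sum.cong) auto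
    finally show ?thesis
      using that by simp
  qed
  assume u: "u \<in> carrier_vec N" "\<And>i. i < N \<Longrightarrow> u $ i = (\<Sum>k<m. x k * p k $ i)"
  have "braket u v = (\<Sum>i<N. (\<Sum>k<m. cnj (x k) * cnj (p k $ i)) * v $ i)"
    using u by (simp add: braket_sum)
  also have "\<dots> = (\<Sum>k<m. cnj (x k) * (\<Sum>i<N. cnj (p k $ i) * v $ i))"
    unfolding sum_distrib_left sum_distrib_right by (subst sum.swap) (simp add: mult.assoc)
  also have "\<dots> = (\<Sum>k<m. cnj (x k) * y k)"
    using coeff braket_sum[OF p] by (intro sum.cong) auto
  finally show "braket u v = (\<Sum>k<m. cnj (x k) * y k)" .
qed

text \<open>A vector common to both bases would give inner product 1, whereas
  \<open>1 / sqrt m\<close> differs from 1 for \<open>m > 1\<close>; so the bases are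
  distinct.\<close>

lemma mutually_unbiasedI:
  assumes "onb_of N S m f" and "onb_of N S m g" and "m > 1"
    and unbiased: "\<And>i j. i < m \<Longrightarrow> j < m \<Longrightarrow> cmod (braket (f i) (g j)) = 1 / sqrt (of_nat m)"
  shows "mutually_unbiased N S m f g"
proof -
  have "f ` {..<m} \<noteq> g ` {..<m}"
  proof
    assume "f ` {..<m} = g ` {..<m}"
    moreover have "f 0 \<in> f ` {..<m}"
      using assms(3) by simp
    ultimately obtain j where "j < m" "f 0 = g j"
      by auto
    then have "braket (f 0) (g j) = 1"
      using assms(2) by (simp add: onb_of_def)
    then show False
      using unbiased[of 0 j] \<open>j < m\<close> assms(3) by simp
  qed
  then show ?thesis
    using assms by (simp add: mutually_unbiased_def)
qed

section \<open>Orthonormality and entanglement of the states\<close>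

lemma power_state_carrier [simp]: "power_state d W k \<in> carrier_vec (d * d)"
  by (simp add: power_state_def)

lemma power_state_index:
  "i < d * d \<Longrightarrow> power_state d W k $ i = (W ^\<^sub>m k) $$ (i mod d, i div d) / of_real (sqrt (of_nat d))"
  by (simp add: power_state_def vec_of_op_index)

lemma mub_state_carrier [simp]: "mub_state d W r s \<in> carrier_vec (d * d)"
  unfolding mub_state_def by (auto intro!: finsum_vec_closed)

lemma mub_state_index:
  assumes "odd d" "i < d * d"
  shows "mub_state d W r s $ i
    = (\<Sum>k<d. chirp d (int r) (- int s) (int k) * (W ^\<^sub>m k) $$ (i mod d, i div d)) / of_nat d"
proof -
  let ?h = "\<lambda>k. ((omega d ^ s) ^ (d - k) * (omega d powi (- int r)) ^ alpha d k) \<cdot>\<^sub>v vec_of_op d (W ^\<^sub>m k)"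
  have closed: "finsum_vec TYPE(complex) (d * d) ?h {..<d} \<in> carrier_vec (d * d)"
    by (rule finsum_vec_closed) auto
  have "finsum_vec TYPE(complex) (d * d) ?h {..<d} $ i = (\<Sum>k<d. ?h k $ i)"
    using assms(2) by (intro index_finsum_vec) auto
  also have "\<dots> = (\<Sum>k<d. chirp d (int r) (- int s) (int k) * (W ^\<^sub>m k) $$ (i mod d, i div d))"
    using assms by (intro sum.cong) (simp_all add: mub_coefficient vec_of_op_index)
  finally show ?thesis
    unfolding mub_state_def using closed assms(2) by simp
qed

text \<open>Of the prefactor \<open>1 / d\<close>, one \<open>1 / sqrt d\<close> normalises the
  power states and the other stays in the coefficient.\<close>

lemma mub_state_combination:
  assumes "odd d" "i < d * d"
  shows "mub_state d W r s $ i
    = (\<Sum>k<d. (chirp d (int r) (- int s) (int k) / of_real (sqrt (of_nat d))) * power_state d W k $ i)"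
proof -
  have "complex_of_real (sqrt (of_nat d)) * of_real (sqrt (of_nat d)) = of_nat d"
    by (simp add: of_real_mult[symmetric] del: of_real_mult)
  then show ?thesis
    by (simp add: mub_state_index[OF assms] power_state_index[OF assms(2)] sum_divide_distrib)
qed

lemma mub_state_in_span:
  "mub_state d W r s \<in> LinearCombinations.module.span class_ring (module_vec TYPE(complex) (d * d)) (power_state d W ` {..<d})"
proof -
  interpret vec_space "TYPE(complex)" "d * d" .
  have sub: "power_state d W ` {..<d} \<subseteq> carrier_vec (d * d)"
    by auto
  have *: "c \<cdot>\<^sub>v vec_of_op d (W ^\<^sub>m k) \<in> span (power_state d W ` {..<d})" if "k < d" for c k
  proof -
    have "c \<cdot>\<^sub>v vec_of_op d (W ^\<^sub>m k) = (c * of_real (sqrt (of_nat d))) \<cdot>\<^sub>v power_state d W k"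
      using that by (simp add: power_state_def smult_smult_assoc)
    then show ?thesis
      using smult_in_span[OF sub] in_own_span[OF sub] that by auto
  qed
  show ?thesis
    unfolding mub_state_def
    by (rule smult_in_span[OF sub], rule finsum_vec_in_span[OF sub])
      (simp_all only: * finite_lessThan lessThan_iff)
qed

text \<open>The inner product of vectorised operators is the trace of the adjoint of one times the
  other, here the trace of a single power of \<open>W\<close>.\<close>

lemma power_state_orthonormal:
  assumes "prime d" "d > 2" and "a < d" "b < d" "(a, b) \<noteq> (0, 0)"
    and W: "W = pauli_X d ^\<^sub>m b * pauli_Z d ^\<^sub>m a" and "l < d" "k < d"
  shows "braket (power_state d W l) (power_state d W k) = (if l = k then 1 else 0)"
proof -
  have odd: "odd d"
    using prime_odd_nat[OF assms(1,2)] .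
  have "complex_of_real (sqrt (of_nat d)) * of_real (sqrt (of_nat d)) = of_nat d"
    by (simp add: of_real_mult[symmetric] del: of_real_mult)
  then have "braket (power_state d W l) (power_state d W k)
    = (\<Sum>i<d * d. cnj ((W ^\<^sub>m l) $$ (i mod d, i div d)) * (W ^\<^sub>m k) $$ (i mod d, i div d)) / of_nat d"
    by (simp add: braket_sum[OF power_state_carrier] power_state_index sum_divide_distrib)
  also have "(\<Sum>i<d * d. cnj ((W ^\<^sub>m l) $$ (i mod d, i div d)) * (W ^\<^sub>m k) $$ (i mod d, i div d))
    = (\<Sum>m<d. \<Sum>n<d. cnj ((W ^\<^sub>m l) $$ (n, m)) * (W ^\<^sub>m k) $$ (n, m))"
    by (rule sum_div_mod)
  also have "\<dots> = (\<Sum>m<d. (W ^\<^sub>m ((k + d - l) mod d)) $$ (m, m))"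
    using assms(7,8) by (simp add: weyl_power_adjoint_mult[OF odd W])
  also have "\<dots> = (if (k + d - l) mod d = 0 then of_nat d else 0)"
    using assms(2) by (intro weyl_power_trace[OF assms(1-6)]) simp
  also have "(k + d - l) mod d = 0 \<longleftrightarrow> l = k"
    using assms(7,8) by (cases "k < l") (auto simp: mod_if)
  finally show ?thesis
    using assms(2) by simp
qed

lemma power_state_maximally_entangled:
  assumes "odd d" and W: "W = pauli_X d ^\<^sub>m b * pauli_Z d ^\<^sub>m a" and "k < d"
  shows "maximally_entangled d (power_state d W k)"
proof (rule maximally_entangledI)
  show "d > 0" using assms(1) by (rule odd_pos)
  show "power_state d W k \<in> carrier_vec (d * d)" by simp
  show "power_state d W k $ i = (W ^\<^sub>m k) $$ (i mod d, i div d) / of_real (sqrt (of_nat d))"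
    if "i < d * d" for i
    using that by (rule power_state_index)
  have sqrt: "complex_of_real (sqrt (of_nat d)) * of_real (sqrt (of_nat d)) = of_nat d"
    by (simp add: of_real_mult[symmetric] del: of_real_mult)
  fix i j assume ij: "i < d" "j < d"
  have "(\<Sum>n<d. cnj ((W ^\<^sub>m k) $$ (n, i) / of_real (sqrt (of_nat d))) * ((W ^\<^sub>m k) $$ (n, j) / of_real (sqrt (of_nat d))))
    = (\<Sum>n<d. cnj ((W ^\<^sub>m k) $$ (n, i)) * (W ^\<^sub>m k) $$ (n, j)) / of_nat d"
    by (simp add: sqrt sum_divide_distrib)
  \<comment> \<open>Equal exponents give \<open>(k + d - k) mod d = 0\<close>, so this is the
    unitarity of \<open>W ^\<^sub>m k\<close>.\<close>
  also have "\<dots> = (W ^\<^sub>m 0) $$ (i, j) / of_nat d"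
    using weyl_power_adjoint_mult[OF assms(1) W ij assms(3,3)] by simp
  also have "\<dots> = (if i = j then 1 / of_nat d else 0)"
    using ij by (simp add: weyl_power_index[OF assms(1) W] chirp_def del: pow_mat.simps)
  finally show "(\<Sum>n<d. cnj ((W ^\<^sub>m k) $$ (n, i) / of_real (sqrt (of_nat d))) * ((W ^\<^sub>m k) $$ (n, j) / of_real (sqrt (of_nat d))))
    = (if i = j then 1 / of_nat d else 0)" .
qed

text \<open>The coefficient matrix is a chirp-weighted sum of powers of \<open>W\<close> over
  \<open>d\<close>. Its adjoint times itself is a double sum of powers with exponents
  \<open>k - l\<close> over \<open>d * d\<close>, of which the autocorrelation leaves
  \<open>d\<close> times the identity.\<close>

lemma mub_state_maximally_entangled:
  assumes "prime d" "d > 2" and W: "W = pauli_X d ^\<^sub>m b * pauli_Z d ^\<^sub>m a" and "\<not> int d dvd int r"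
  shows "maximally_entangled d (mub_state d W r s)"
proof (rule maximally_entangledI)
  have odd: "odd d"
    using prime_odd_nat[OF assms(1,2)] .
  let ?c = "\<lambda>k. chirp d (int r) (- int s) (int k)"
  show d: "d > 0" using assms(2) by simp
  show "mub_state d W r s \<in> carrier_vec (d * d)" by simp
  show "mub_state d W r s $ i = (\<Sum>k<d. ?c k * (W ^\<^sub>m k) $$ (i mod d, i div d)) / of_nat d"
    if "i < d * d" for i
    using odd that by (rule mub_state_index)
  fix i j assume ij: "i < d" "j < d"
  let ?w = "\<lambda>k n m. (W ^\<^sub>m k) $$ (n, m)"
  have "(\<Sum>n<d. cnj ((\<Sum>l<d. ?c l * ?w l n i) / of_nat d) * ((\<Sum>k<d. ?c k * ?w k n j) / of_nat d))
    = (\<Sum>n<d. (\<Sum>k<d. ?c k * ?w k n j) * (\<Sum>l<d. cnj (?c l) * cnj (?w l n i))) / (of_nat d * of_nat d)"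
    by (simp add: sum_divide_distrib[symmetric] mult.commute)
  also have "(\<Sum>n<d. (\<Sum>k<d. ?c k * ?w k n j) * (\<Sum>l<d. cnj (?c l) * cnj (?w l n i)))
    = (\<Sum>k<d. \<Sum>l<d. \<Sum>n<d. ?c k * cnj (?c l) * (cnj (?w l n i) * ?w k n j))"
  proof -
    have "(\<Sum>n<d. (\<Sum>k<d. ?c k * ?w k n j) * (\<Sum>l<d. cnj (?c l) * cnj (?w l n i)))
      = (\<Sum>n<d. \<Sum>k<d. \<Sum>l<d. ?c k * cnj (?c l) * (cnj (?w l n i) * ?w k n j))"
      unfolding sum_product by (intro sum.cong refl) (simp only: mult_ac)
    also have "\<dots> = (\<Sum>k<d. \<Sum>n<d. \<Sum>l<d. ?c k * cnj (?c l) * (cnj (?w l n i) * ?w k n j))"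
      by (rule sum.swap)
    also have "\<dots> = (\<Sum>k<d. \<Sum>l<d. \<Sum>n<d. ?c k * cnj (?c l) * (cnj (?w l n i) * ?w k n j))"
      by (intro sum.cong refl sum.swap)
    finally show ?thesis .
  qed
  also have "\<dots> = (\<Sum>k<d. \<Sum>l<d. ?c k * cnj (?c l) * ?w ((k + d - l) mod d) i j)"
    unfolding sum_distrib_left[symmetric]
    by (intro sum.cong refl) (simp only: weyl_power_adjoint_mult[OF odd W ij] lessThan_iff)
  \<comment> \<open>The weight is the \<open>(i, j)\<close> entry of \<open>W ^\<^sub>m m\<close>,
    evaluated at \<open>m = 0\<close>.\<close>
  also have "\<dots> = of_nat d * ?w 0 i j"
    by (rule chirp_autocorrelation[OF assms(1,2,4)])
  also have "\<dots> = of_nat d * (if i = j then 1 else 0)"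
    using ij by (simp add: weyl_power_index[OF odd W] chirp_def del: pow_mat.simps)
  finally show "(\<Sum>n<d. cnj ((\<Sum>l<d. ?c l * ?w l n i) / of_nat d) * ((\<Sum>k<d. ?c k * ?w k n j) / of_nat d))
    = (if i = j then 1 / of_nat d else 0)"
    using d by simp
qed

section \<open>Assembling the pairwise unbiased bases\<close>

theorem mainTheorem3:
  fixes d a b :: nat and W :: "complex mat"
  assumes "prime d" and "d > 2"
    and "a < d" and "b < d" and "(a, b) \<noteq> (0, 0)"
    and "W = pauli_X d ^\<^sub>m b * pauli_Z d ^\<^sub>m a"
  shows "\<exists>S. VectorSpace.subspace class_ring S (module_vec TYPE(complex) (d * d)) \<and>
    vectorspace.dim class_ring (module_vec TYPE(complex) (d * d)\<lparr>carrier := S\<rparr>) = d \<and>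
    (\<forall>k<d. maximally_entangled d (power_state d W k)) \<and>
    onb_of (d * d) S d (power_state d W) \<and>
    (\<forall>r\<in>{1..d - 1}.
       onb_of (d * d) S d (mub_state d W r) \<and>
       (\<forall>s<d. maximally_entangled d (mub_state d W r s)) \<and>
       mutually_unbiased (d * d) S d (power_state d W) (mub_state d W r)) \<and>
    (\<forall>r\<in>{1..d - 1}. \<forall>r'\<in>{1..d - 1}. r \<noteq> r' \<longrightarrow>
       mutually_unbiased (d * d) S d (mub_state d W r) (mub_state d W r'))"
proof -
  let ?S = "LinearCombinations.module.span class_ring (module_vec TYPE(complex) (d * d)) (power_state d W ` {..<d})"
  have odd: "odd d" and d: "d > 0"
    using prime_odd_nat[OF assms(1,2)] assms(2) by auto
  note orth = power_state_orthonormal[OF assms]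
  note span = onb_of_span[of d "power_state d W" "d * d", OF power_state_carrier orth]
  have sqrt: "complex_of_real (sqrt (of_nat d)) * of_real (sqrt (of_nat d)) = of_nat d"
    by (simp add: of_real_mult[symmetric] del: of_real_mult)
  note comb = braket_combination[of d "power_state d W" "d * d", OF power_state_carrier orth
      mub_state_combination[OF odd]]
  \<comment> \<open>The inner product is a single coefficient of the combination, a number of
    modulus 1 over \<open>sqrt d\<close>.\<close>
  have mixed: "cmod (braket (power_state d W k) (mub_state d W r s)) = 1 / sqrt (of_nat d)"
    if "k < d" for k r s
    using that by (simp add: comb(1) norm_divide)
  \<comment> \<open>Conjugation subtracts the parameters: for \<open>r = r'\<close> a character sum
    remains, which gives orthonormality; for distinct \<open>r\<close> and \<open>r'\<close> in the
    range it is a Gauss sum, which gives unbiasedness.\<close>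
  have braket: "braket (mub_state d W r s) (mub_state d W r' s')
    = (\<Sum>k<d. chirp d (int r' - int r) (int s - int s') (int k)) / of_nat d" for r s r' s'
    by (subst comb(2)[OF _ _ _ mub_state_carrier mub_state_combination[OF odd]])
      (simp_all add: chirp_cnj_mult sqrt sum_divide_distrib)
  have dvd_diff: "int d dvd int i - int j \<longleftrightarrow> i = j" if "i < d" "j < d" for i j
    using that by (simp add: mod_eq_dvd_iff[symmetric])
  have mub_orth: "braket (mub_state d W r s) (mub_state d W r s') = (if s = s' then 1 else 0)"
    if "s < d" "s' < d" for r s s'
    using d by (simp add: braket chirp_def sum_chi[OF d] dvd_diff[OF that])
  have onb: "onb_of (d * d) ?S d (mub_state d W r)" for r
    by (rule onb_of_subspaceI[OF span(1,2) mub_state_in_span mub_orth])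
  have "mutually_unbiased (d * d) ?S d (power_state d W) (mub_state d W r)" for r
    using assms(2) by (intro mutually_unbiasedI span(2) onb mixed) simp_all
  moreover have "mutually_unbiased (d * d) ?S d (mub_state d W r) (mub_state d W r')"
    if "r \<in> {1..d - 1}" "r' \<in> {1..d - 1}" "r \<noteq> r'" for r r'
  proof (rule mutually_unbiasedI[OF onb onb])
    have "\<not> int d dvd int r' - int r"
    proof -
      have "r < d" "r' < d" using that d by auto
      then show ?thesis using dvd_diff[of r' r] that(3) by simp
    qed
    then have "cmod (braket (mub_state d W r s) (mub_state d W r' s')) = sqrt (of_nat d) / of_nat d" for s s'
      by (simp add: braket norm_divide gauss_sum_cmod[OF assms(1,2)])
    then show "cmod (braket (mub_state d W r s) (mub_state d W r' s')) = 1 / sqrt (of_nat d)" for s s'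
      by (simp add: real_div_sqrt sqrt_divide_self_eq inverse_eq_divide)
  qed (use assms(2) in simp)
  moreover have "maximally_entangled d (mub_state d W r s)" if "r \<in> {1..d - 1}" for r s
      proof (rule mub_state_maximally_entangled[OF assms(1,2,6)])
    have "r < d" "r \<noteq> 0" using that d by auto
    then show "\<not> int d dvd int r" using dvd_diff[of r 0] d by simp
  qed
  ultimately show ?thesis
    using span(1-3) onb power_state_maximally_entangled[OF odd assms(6)]
    by (intro exI[of _ ?S]) auto
qed

end
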